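(* Let $m\ge3$, $n\ge2$, and let $\mathcal{A}$ be a real symmetric $m$-th order $n$-dimensional tensor that is copositive. Then for any nonempty $J\subseteq[n]$, the system $\mathcal{A}_J\mathbf{x}^{m-1}\ge\mathbf{0}$ admits a nonzero solution $\mathbf{x}\in\mathbb{R}^{|J|}_+$.
   Context: $[n]=\{1,\dots,n\}$. A symmetric tensor $\mathcal{A}=(a_{i_1\cdots i_m})$ has entries invariant under permutation of indices; $\mathcal{A}\mathbf{x}^m=\sum a_{i_1\cdots i_m}x_{i_1}\cdots x_{i_m}$, and $\mathcal{A}$ is copositive if $\mathcal{A}\mathbf{x}^m\ge0$ for all $\mathbf{x}\in\mathbb{R}^n_+$. For $J\subseteq[n]$, the principal subtensor $\mathcal{A}_J$ is the $m$-th order $|J|$-dimensional tensor with entries $a_{i_1\cdots i_m}$, $i_1,\dots,i_m\in J$. For a tensor $\mathcal{B}=(b_{i_1\cdots i_m})$ of dimension $d$ and $\mathbf{x}\in\mathbb{R}^d$, $\mathcal{B}\mathbf{x}^{m-1}\in\mathbb{R}^d$ has components $(\mathcal{B}\mathbf{x}^{m-1})_i=\sum_{i_2,\dots,i_m}b_{ii_2\cdots i_m}x_{i_2}\cdots x_{i_m}$; the inequality $\ge\mathbf{0}$ is componentwise. *)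

theory Defs
  imports
    "HOL-Combinatorics.Permutations"
    "Jordan_Normal_Form.DL_Submatrix"
begin

text \<open>
  A real \<open>m\<close>-th order \<open>n\<close>-dimensional tensor is given by its entries \<open>A [i\<^sub>1, \<dots>, i\<^sub>m]\<close>, where, in
  accordance with the type \<open>vec\<close>, indices are 0-based, so that \<open>{1, \<dots>, n}\<close> becomes \<open>{..<n}\<close>.
  Values of \<open>A\<close> outside \<open>multi_indices m n\<close> are irrelevant.
\<close>

type_synonym tensor = "nat list \<Rightarrow> real"

definition multi_indices :: "nat \<Rightarrow> nat \<Rightarrow> nat list set" where
  "multi_indices m n = {is. length is = m \<and> set is \<subseteq> {..<n}}"

lemma finite_multi_indices: "finite (multi_indices m n)"
  using finite_lists_length_eq[of "{..<n}" m] by (simp add: multi_indices_def conj_commute)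

definition symmetric_tensor :: "nat \<Rightarrow> nat \<Rightarrow> tensor \<Rightarrow> bool" where
  "symmetric_tensor m n A \<longleftrightarrow>
     (\<forall>is \<in> multi_indices m n. \<forall>\<pi>. \<pi> permutes {..<m} \<longrightarrow> A (permute_list \<pi> is) = A is)"

definition nonneg_orthant :: "nat \<Rightarrow> real vec set" where
  "nonneg_orthant n = {x \<in> carrier_vec n. 0\<^sub>v n \<le> x}"

text \<open>The scalar \<open>A x\<^sup>m\<close>:\<close>

definition tensor_form :: "nat \<Rightarrow> nat \<Rightarrow> tensor \<Rightarrow> real vec \<Rightarrow> real" where
  "tensor_form m n A x = (\<Sum>is \<in> multi_indices m n. A is * (\<Prod>j<m. x $ (is ! j)))"

text \<open>The vector \<open>A x\<^bsup>m-1\<^esup>\<close>, meant for \<open>m \<ge> 1\<close>; here \<open>is = [i\<^sub>2, \<dots>, i\<^sub>m]\<close>:\<close>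

definition tensor_apply :: "nat \<Rightarrow> nat \<Rightarrow> tensor \<Rightarrow> real vec \<Rightarrow> real vec" where
  "tensor_apply m n A x =
     vec n (\<lambda>i. \<Sum>is \<in> multi_indices (m - 1) n. A (i # is) * (\<Prod>j<m - 1. x $ (is ! j)))"

definition copositive_tensor :: "nat \<Rightarrow> nat \<Rightarrow> tensor \<Rightarrow> bool" where
  "copositive_tensor m n A \<longleftrightarrow> (\<forall>x \<in> nonneg_orthant n. tensor_form m n A x \<ge> 0)"

text \<open>
  The \<open>card J\<close>-dimensional tensor obtained by restricting the indices to \<open>J\<close>. As for \<open>submatrix\<close>,
  \<open>J\<close> is identified with \<open>{..<card J}\<close> by its increasing enumeration \<open>pick J\<close>.
\<close>

definition principal_subtensor :: "tensor \<Rightarrow> nat set \<Rightarrow> tensor" where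
  "principal_subtensor A J = (\<lambda>is. A (map (pick J) is))"

end

theory Submission
  imports Defs "HOL-Analysis.Function_Topology"
begin

text \<open>
  Copositivity passes to the principal subtensor \<open>B = A\<^sub>J\<close>, because \<open>B x\<^sup>m = A y\<^sup>m\<close> for the
  extension \<open>y\<close> of \<open>x\<close> by zero. Hence \<open>B x\<^sup>m\<close> has a minimum \<open>c \<ge> 0\<close> on the standard simplex,
  attained at some \<open>x\<close>. By homogeneity, \<open>B (x + t e\<^sub>i)\<^sup>m \<ge> c (1 + t)\<^sup>m\<close> for all \<open>t \<ge> 0\<close>, with
  equality at \<open>t = 0\<close>. Since \<open>B\<close> is symmetric, comparing derivatives at \<open>0\<close> gives
  \<open>m (B x\<^bsup>m-1\<^esup>)\<^sub>i \<ge> m c \<ge> 0\<close>.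
\<close>

section \<open>Tensor forms and multi-indices\<close>

lemma multi_indices_nth_less: "is \<in> multi_indices m n \<Longrightarrow> j < m \<Longrightarrow> is ! j < n"
  by (auto simp: multi_indices_def dest!: nth_mem)

text \<open>Vectors are written as \<open>vec d x\<close> with
  \<open>x :: nat \<Rightarrow> real\<close>, so that continuity and compactness can be taken in the
  product topology on functions. Every index that occurs is below \<open>d\<close>, hence the lookup
  in \<open>vec d x\<close> is just an application of \<open>x\<close>.\<close>

lemma tensor_form_vec:
  "tensor_form m d B (vec d x) = (\<Sum>is \<in> multi_indices m d. B is * (\<Prod>j<m. x (is ! j)))"
  unfolding tensor_form_def
  by (intro sum.cong prod.cong arg_cong2[of _ _ _ _ "(*)"] refl) (simp add: multi_indices_nth_less)

lemma tensor_apply_vec: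
  "tensor_apply m d B (vec d x) =
     vec d (\<lambda>i. \<Sum>is \<in> multi_indices (m - 1) d. B (i # is) * (\<Prod>j<m - 1. x (is ! j)))"
  unfolding tensor_apply_def
  by (intro arg_cong[of _ _ "vec d"] ext sum.cong prod.cong arg_cong2[of _ _ _ _ "(*)"] refl)
    (simp add: multi_indices_nth_less)

lemma vec_in_nonneg_orthant_iff: "vec d x \<in> nonneg_orthant d \<longleftrightarrow> (\<forall>i<d. x i \<ge> 0)"
  by (auto simp: nonneg_orthant_def less_eq_vec_def)

lemma nonneg_orthantD:
  assumes "x \<in> nonneg_orthant d" and "i < d"
  shows "vec_index x i \<ge> 0"
proof -
  have "x \<in> carrier_vec d" "0\<^sub>v d \<le> x"
    using assms(1) by (simp_all add: nonneg_orthant_def)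
  then have "vec_index (0\<^sub>v d) i \<le> vec_index x i"
    using assms(2) unfolding less_eq_vec_def carrier_vec_def by simp
  then show ?thesis
    using assms(2) by simp
qed

lemma tensor_form_scale:
  "tensor_form m d B (vec d (\<lambda>i. r * x i)) = r ^ m * tensor_form m d B (vec d x)"
  unfolding tensor_form_vec sum_distrib_left by (rule sum.cong) (simp_all add: prod.distrib)

lemma multi_indices_Suc:
  "multi_indices (Suc m) d = (\<lambda>(i, is). i # is) ` ({..<d} \<times> multi_indices m d)"
proof (intro equalityI subsetI)
  fix "is" assume "is": "is \<in> multi_indices (Suc m) d"
  then obtain i "is'" where "is = i # is'"
    by (cases "is") (auto simp: multi_indices_def)
  with "is" show "is \<in> (\<lambda>(i, is). i # is) ` ({..<d} \<times> multi_indices m d)"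
    by (auto simp: multi_indices_def)
qed (auto simp: multi_indices_def)

lemma sum_multi_indices_Suc:
  "(\<Sum>is \<in> multi_indices (Suc m) d. f is) = (\<Sum>i<d. \<Sum>is \<in> multi_indices m d. f (i # is))"
  unfolding multi_indices_Suc
  by (subst sum.reindex) (auto simp: inj_on_def sum.cartesian_product case_prod_unfold)

section \<open>Symmetry and the directional derivative of the form\<close>

lemma permute_list_in_multi_indices:
  assumes "\<pi> permutes {..<m}" and "is \<in> multi_indices m d"
  shows "permute_list \<pi> is \<in> multi_indices m d"
  using assms by (auto simp: multi_indices_def)

text \<open>Exchanging positions \<open>0\<close> and \<open>j\<close> is an involution on
  multi-indices that fixes the entries of \<open>B\<close> and moves the distinguished factor
  \<open>y\<close> from position \<open>j\<close> to position \<open>0\<close>.\<close>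

lemma symmetric_tensor_sum_swap:
  assumes B: "symmetric_tensor m d B" and j: "j < m"
  shows "(\<Sum>is \<in> multi_indices m d. B is * (y (is ! j) * (\<Prod>k\<in>{..<m} - {j}. x (is ! k)))) =
         (\<Sum>is \<in> multi_indices m d. B is * (y (is ! 0) * (\<Prod>k\<in>{..<m} - {0}. x (is ! k))))"
proof -
  define \<pi> where "\<pi> = transpose 0 j"
  have p: "\<pi> permutes {..<m}"
    using j by (auto simp: \<pi>_def intro!: permutes_swap_id)
  have inv: "permute_list \<pi> (permute_list \<pi> is) = is" if "is \<in> multi_indices m d" for "is"
  proof -
    have "permute_list (\<pi> \<circ> \<pi>) is = permute_list \<pi> (permute_list \<pi> is)"
      by (rule permute_list_compose) (use p that in \<open>auto simp: multi_indices_def\<close>)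
    then show ?thesis
      by (simp add: \<pi>_def)
  qed
  show ?thesis
  proof (rule sum.reindex_bij_witness[of _ "permute_list \<pi>" "permute_list \<pi>"])
    fix "is" assume "is": "is \<in> multi_indices m d"
    then have nth: "permute_list \<pi> is ! k = is ! \<pi> k" if "k < m" for k
      using p that by (auto simp: multi_indices_def permute_list_nth)
    have "(\<Prod>k\<in>{..<m} - {0}. x (permute_list \<pi> is ! k)) = (\<Prod>k\<in>{..<m} - {0}. x (is ! \<pi> k))"
      by (rule prod.cong) (auto simp: nth)
    also have "\<dots> = (\<Prod>k\<in>{..<m} - {j}. x (is ! k))"
      by (rule prod.reindex_bij_witness[of _ \<pi> \<pi>])
        (use j in \<open>auto simp: \<pi>_def transpose_def split: if_splits\<close>)
    finally have "(\<Prod>k\<in>{..<m} - {0}. x (permute_list \<pi> is ! k)) = (\<Prod>k\<in>{..<m} - {j}. x (is ! k))" .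
    moreover have "permute_list \<pi> is ! 0 = is ! j"
      using nth[of 0] j by (simp add: \<pi>_def)
    moreover have "B (permute_list \<pi> is) = B is"
      using B p "is" by (auto simp: symmetric_tensor_def)
    ultimately show "B (permute_list \<pi> is) * (y (permute_list \<pi> is ! 0) *
        (\<Prod>k\<in>{..<m} - {0}. x (permute_list \<pi> is ! k))) =
      B is * (y (is ! j) * (\<Prod>k\<in>{..<m} - {j}. x (is ! k)))"
      by simp
  qed (use p inv permute_list_in_multi_indices in auto)
qed

text \<open>The product rule yields one sum for each position whose factor is differentiated. By
  symmetry these \<open>m\<close> sums coincide, and splitting off the first index in the sum for
  position \<open>0\<close> produces \<open>tensor_apply\<close>.\<close>

lemma tensor_form_has_derivative_along:
  fixes x y :: "nat \<Rightarrow> real"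
  assumes B: "symmetric_tensor m d B" and m: "m > 0"
  shows "((\<lambda>t. tensor_form m d B (vec d (\<lambda>i. x i + t * y i))) has_real_derivative
           m * (\<Sum>i<d. y i * vec_index (tensor_apply m d B (vec d x)) i)) (at 0)"
proof -
  obtain m' where m': "m = Suc m'"
    using m by (cases m) auto
  let ?D = "\<lambda>j. \<Sum>is \<in> multi_indices m d. B is * (y (is ! j) * (\<Prod>k\<in>{..<m} - {j}. x (is ! k)))"
  have "((\<lambda>t. \<Sum>is \<in> multi_indices m d. B is * (\<Prod>j<m. x (is ! j) + t * y (is ! j)))
      has_real_derivative
        (\<Sum>is \<in> multi_indices m d. B is * (\<Sum>j<m. y (is ! j) * (\<Prod>k\<in>{..<m} - {j}. x (is ! k) + 0 * y (is ! k)))))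
      (at 0)"
    by (intro DERIV_sum DERIV_cmult has_field_derivative_prod) (auto intro!: derivative_eq_intros)
  also have "(\<Sum>is \<in> multi_indices m d. B is * (\<Sum>j<m. y (is ! j) * (\<Prod>k\<in>{..<m} - {j}. x (is ! k) + 0 * y (is ! k))))
      = (\<Sum>j<m. ?D j)"
    by (simp add: sum_distrib_left) (rule sum.swap)
  also have "\<dots> = (\<Sum>j<m. ?D 0)"
    by (rule sum.cong[OF refl], rule symmetric_tensor_sum_swap[OF B]) simp
  also have "\<dots> = m * ?D 0"
    by simp
  also have "?D 0 = (\<Sum>i<d. \<Sum>is \<in> multi_indices m' d. B (i # is) * (y i * (\<Prod>k<m'. x (is ! k))))"
  proof -
    have "(\<Prod>k\<in>{..<m} - {0}. x ((i # is) ! k)) = (\<Prod>k<m'. x (is ! k))" for i "is"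
      \<comment> \<open>Positions \<open>1, ..., m'\<close> of \<open>i # is\<close> are positions
        \<open>0, ..., m' - 1\<close> of \<open>is\<close>.\<close>
      unfolding m' by (rule prod.reindex_bij_witness[of _ Suc "\<lambda>k. k - 1"]) auto
    then show ?thesis
      by (simp add: m' sum_multi_indices_Suc)
  qed
  also have "\<dots> = (\<Sum>i<d. y i * vec_index (tensor_apply m d B (vec d x)) i)"
    by (simp add: tensor_apply_vec m' sum_distrib_left mult_ac)
  finally show ?thesis
    by (simp add: tensor_form_vec)
qed

section \<open>The minimum over the standard simplex\<close>

definition simplex_fun :: "nat \<Rightarrow> (nat \<Rightarrow> real) set" where
  "simplex_fun d = {x. (\<forall>i<d. x i \<ge> 0) \<and> (\<forall>i\<ge>d. x i = 0) \<and> (\<Sum>i<d. x i) = 1}"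

text \<open>By Tychonoff, the box with sides \<open>{0..1}\<close> below \<open>d\<close> and
  \<open>{0}\<close> from \<open>d\<close> on is compact, and the condition on the sum is closed.
  Fixing the irrelevant coordinates to \<open>0\<close> is what keeps the set inside such a
  box.\<close>

lemma compact_simplex_fun: "compact (simplex_fun d)"
proof -
  let ?K = "PiE UNIV (\<lambda>i. if i < d then {0..1} else {0}) :: (nat \<Rightarrow> real) set"
  have "compactin (product_topology (\<lambda>_. euclidean) UNIV) ?K"
    by (auto simp: compactin_PiE)
  then have "compact ?K"
    by (simp add: euclidean_product_topology)
  moreover have "closed {x :: nat \<Rightarrow> real. (\<Sum>i<d. x i) = 1}"
    by (intro closed_Collect_eq continuous_intros continuous_on_product_coordinates)
  moreover have "simplex_fun d = ?K \<inter> {x. (\<Sum>i<d. x i) = 1}"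
  proof -
    have "x i \<le> 1" if "x \<in> simplex_fun d" "i < d" for x i
      using member_le_sum[of i "{..<d}" x] that by (auto simp: simplex_fun_def)
    then show ?thesis
      by (auto simp: simplex_fun_def PiE_iff split: if_splits)
  qed
  ultimately show ?thesis
    by (simp add: compact_Int_closed)
qed

lemma tensor_form_attains_min_on_simplex:
  assumes "d > 0"
  obtains x where "x \<in> simplex_fun d"
    and "\<And>y. y \<in> simplex_fun d \<Longrightarrow> tensor_form m d B (vec d x) \<le> tensor_form m d B (vec d y)"
proof -
  \<comment> \<open>The first vertex shows that the simplex is nonempty; it exists because
    \<open>d > 0\<close>.\<close>
  have "(\<lambda>i. if i = 0 then 1 else 0) \<in> simplex_fun d"
    using assms by (auto simp: simplex_fun_def)
  then have "simplex_fun d \<noteq> {}"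
    by blast
  moreover have "continuous_on (simplex_fun d) (\<lambda>x. tensor_form m d B (vec d x))"
    unfolding tensor_form_vec
    by (intro continuous_intros continuous_on_subset[OF continuous_on_product_coordinates]) auto
  ultimately show ?thesis
    using continuous_attains_inf[OF compact_simplex_fun] that by blast
qed

lemma copositive_tensor_apply_nonneg:
  assumes B: "symmetric_tensor m d B" "copositive_tensor m d B" and m: "m > 0" and d: "d > 0"
  shows "\<exists>x \<in> nonneg_orthant d. x \<noteq> 0\<^sub>v d \<and> tensor_apply m d B x \<ge> 0\<^sub>v d"
proof -
  obtain x where x: "x \<in> simplex_fun d" and
    x_min: "\<And>y. y \<in> simplex_fun d \<Longrightarrow> tensor_form m d B (vec d x) \<le> tensor_form m d B (vec d y)"
    using tensor_form_attains_min_on_simplex[OF d] by blast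
  define c where "c = tensor_form m d B (vec d x)"
  have x_nonneg: "x i \<ge> 0" for i
    using x by (cases "i < d") (auto simp: simplex_fun_def)
  have x_sum: "(\<Sum>i<d. x i) = 1"
    using x by (simp add: simplex_fun_def)
  have x_orthant: "vec d x \<in> nonneg_orthant d"
    by (simp add: vec_in_nonneg_orthant_iff x_nonneg)
  then have c: "c \<ge> 0"
    using B by (simp add: c_def copositive_tensor_def)
  \<comment> \<open>The minimizer satisfies a bound stronger than nonnegativity: each component is
    at least the minimum value \<open>c\<close>.\<close>
  have "vec_index (tensor_apply m d B (vec d x)) i \<ge> c" if i: "i < d" for i
  proof (rule ccontr)
    let ?y = "\<lambda>j. if j = i then 1 else 0 :: real"
    let ?f = "\<lambda>t. tensor_form m d B (vec d (\<lambda>j. x j + t * ?y j))"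
    let ?\<phi> = "\<lambda>t. ?f t - c * (1 + t) ^ m"
    assume "\<not> vec_index (tensor_apply m d B (vec d x)) i \<ge> c"
    then have neg: "m * (vec_index (tensor_apply m d B (vec d x)) i - c) < 0"
      using m by (simp add: mult_less_0_iff)
    have "(\<Sum>j<d. ?y j * vec_index (tensor_apply m d B (vec d x)) j) =
        (\<Sum>j<d. if j = i then vec_index (tensor_apply m d B (vec d x)) j else 0)"
      by (rule sum.cong) auto
    also have "\<dots> = vec_index (tensor_apply m d B (vec d x)) i"
      using i by simp
    finally have "(?f has_real_derivative m * vec_index (tensor_apply m d B (vec d x)) i) (at 0)"
      using tensor_form_has_derivative_along[OF B(1) m, of x ?y] by simp
    then have "(?\<phi> has_real_derivative m * (vec_index (tensor_apply m d B (vec d x)) i - c)) (at 0)"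
      by (auto intro!: derivative_eq_intros simp: algebra_simps)
    \<comment> \<open>A negative derivative at \<open>0\<close> forces \<open>?\<phi>\<close> below
      \<open>?\<phi> 0 = 0\<close> just to the right of \<open>0\<close>, while minimality gives
      \<open>?\<phi> t \<ge> 0\<close> there.\<close>
    from DERIV_neg_dec_right[OF this neg]
    obtain \<epsilon> where \<epsilon>: "\<epsilon> > 0" "\<And>h. 0 < h \<Longrightarrow> h < \<epsilon> \<Longrightarrow> ?\<phi> h < ?\<phi> 0"
      by auto
    define t where "t = \<epsilon> / 2"
    have t: "t > 0" "t < \<epsilon>"
      using \<epsilon>(1) by (auto simp: t_def)
    \<comment> \<open>Moving from \<open>x\<close> by \<open>t\<close> along the \<open>i\<close>-th
      coordinate raises the coordinate sum to \<open>1 + t\<close>; dividing by it returns to the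
      simplex, where minimality applies.\<close>
    define z where "z = (\<lambda>j. (x j + t * ?y j) / (1 + t))"
    have "(\<Sum>j<d. z j) = (\<Sum>j<d. x j + t * ?y j) / (1 + t)"
      by (simp only: z_def sum_divide_distrib)
    also have "\<dots> = 1"
      using i t x_sum by (simp add: sum.distrib flip: sum_distrib_left)
    finally have "z \<in> simplex_fun d"
      using x t i by (auto simp: simplex_fun_def z_def)
    then have "c * (1 + t) ^ m \<le> (1 + t) ^ m * tensor_form m d B (vec d z)"
      using x_min t by (simp add: c_def mult.commute)
    also have "\<dots> = ?f t"
      using t by (simp add: z_def flip: tensor_form_scale)
    finally have "?\<phi> t \<ge> 0"
      by simp
    moreover have "?\<phi> 0 = 0"
      by (simp add: c_def)
    ultimately show False
      using \<epsilon>(2)[OF t] by linarith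
  qed
  then have "tensor_apply m d B (vec d x) \<ge> 0\<^sub>v d"
    using c by (force simp: less_eq_vec_def tensor_apply_def intro: order_trans)
  moreover have "vec d x \<noteq> 0\<^sub>v d"
  proof
    assume "vec d x = 0\<^sub>v d"
    then have "x i = 0" if "i < d" for i
      using that by (metis index_vec index_zero_vec(1))
    with x_sum show False
      by simp
  qed
  ultimately show ?thesis
    using x_orthant by blast
qed

section \<open>Passage to principal subtensors\<close>

lemma inj_on_pick: "inj_on (pick J) {..<card J}"
proof (cases "finite J")
  case True
  show ?thesis
    \<comment> \<open>An element of \<open>J\<close> determines its rank as the number of smaller
      elements of \<open>J\<close>.\<close>
    by (rule inj_on_inverseI[where g = "\<lambda>k. card {a \<in> J. a < k}"]) (simp add: card_pick_le)
qed simp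

lemma map_pick_in_multi_indices:
  assumes "J \<subseteq> {..<n}" and "is \<in> multi_indices m (card J)"
  shows "map (pick J) is \<in> multi_indices m n"
  using assms pick_in_set_le[of _ J] by (auto simp: multi_indices_def subset_iff)

text \<open>Permuting the positions of a multi-index commutes with renaming its entries by
  \<open>pick J\<close>.\<close>

lemma symmetric_principal_subtensor:
  assumes A: "symmetric_tensor m n A" and J: "J \<subseteq> {..<n}"
  shows "symmetric_tensor m (card J) (principal_subtensor A J)"
  unfolding symmetric_tensor_def principal_subtensor_def
proof (intro ballI allI impI)
  fix "is" \<pi> assume "is": "is \<in> multi_indices m (card J)" and p: "\<pi> permutes {..<m}"
  then have "map (pick J) (permute_list \<pi> is) = permute_list \<pi> (map (pick J) is)"
    by (subst permute_list_map) (auto simp: multi_indices_def)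
  then show "A (map (pick J) (permute_list \<pi> is)) = A (map (pick J) is)"
    using A p map_pick_in_multi_indices[OF J "is"] by (simp add: symmetric_tensor_def)
qed

lemma copositive_principal_subtensor:
  assumes A: "copositive_tensor m n A" and J: "J \<subseteq> {..<n}"
  shows "copositive_tensor m (card J) (principal_subtensor A J)"
  unfolding copositive_tensor_def
proof
  fix x assume x: "x \<in> nonneg_orthant (card J)"
  define p where "p = the_inv_into {..<card J} (pick J)"
  \<comment> \<open>The extension of \<open>x\<close> by zero: \<open>p\<close> turns an enumerated
    element back into its rank.\<close>
  define y where "y k = (if k \<in> pick J ` {..<card J} then vec_index x (p k) else 0)" for k
  have y_pick: "y (pick J i) = vec_index x i" if "i < card J" for i
    using that inj_on_pick[of J] by (simp add: y_def p_def the_inv_into_f_f)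
  have y_nonneg: "y k \<ge> 0" for k
  proof (cases "k \<in> pick J ` {..<card J}")
    case True
    then obtain i where i: "i < card J" and k: "k = pick J i"
      by blast
    have "vec_index x i \<ge> 0"
      using x i by (rule nonneg_orthantD)
    then show ?thesis
      unfolding k y_pick[OF i] .
  qed (simp add: y_def)
  let ?g = "\<lambda>is. A is * (\<Prod>j<m. y (is ! j))"
  have "tensor_form m n A (vec n y) = (\<Sum>is \<in> multi_indices m n. ?g is)"
    by (rule tensor_form_vec)
  also have "\<dots> = (\<Sum>is \<in> map (pick J) ` multi_indices m (card J). ?g is)"
  proof (rule sum.mono_neutral_right)
    show "map (pick J) ` multi_indices m (card J) \<subseteq> multi_indices m n"
      using map_pick_in_multi_indices[OF J] by blast
    show "\<forall>is \<in> multi_indices m n - map (pick J) ` multi_indices m (card J). ?g is = 0"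
    proof
      fix "is" assume "is": "is \<in> multi_indices m n - map (pick J) ` multi_indices m (card J)"
      have "\<not> set is \<subseteq> pick J ` {..<card J}"
      proof
        assume "set is \<subseteq> pick J ` {..<card J}"
        then obtain "is'" where "is'": "is' \<in> lists {..<card J}" "is = map (pick J) is'"
          by (metis imageE in_listsI lists_image subsetD)
        then have "is' \<in> multi_indices m (card J)"
          using "is" by (auto simp: multi_indices_def)
        then show False
          using "is" "is'"(2) by blast
      qed
      \<comment> \<open>An entry outside the enumerated set contributes a factor zero, so only
        multi-indices over \<open>J\<close> survive in the form of \<open>A\<close> at
        \<open>y\<close>.\<close>
      then obtain k where "k \<in> set is" "k \<notin> pick J ` {..<card J}"
        by blast
      then obtain j where "j < m" "y (is ! j) = 0"
        using "is" by (auto simp: multi_indices_def in_set_conv_nth y_def)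
      then show "?g is = 0"
        by auto
    qed
  qed (rule finite_multi_indices)
  also have "\<dots> = (\<Sum>is \<in> multi_indices m (card J). ?g (map (pick J) is))"
  proof (subst sum.reindex)
    show "inj_on (map (pick J)) (multi_indices m (card J))"
      by (rule inj_on_mapI[OF inj_on_subset[OF inj_on_pick]]) (auto simp: multi_indices_def)
  qed simp
  also have "\<dots> = tensor_form m (card J) (principal_subtensor A J) x"
    unfolding tensor_form_def principal_subtensor_def
  proof (intro sum.cong arg_cong2[of _ _ _ _ "(*)"] prod.cong refl)
    fix "is" j assume "is \<in> multi_indices m (card J)" "j \<in> {..<m}"
    then show "y (map (pick J) is ! j) = vec_index x (is ! j)"
      using multi_indices_nth_less[of "is" m "card J" j] by (simp add: multi_indices_def y_pick)
  qed
  finally have "tensor_form m (card J) (principal_subtensor A J) x = tensor_form m n A (vec n y)" ..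
  moreover have "vec n y \<in> nonneg_orthant n"
    by (simp add: vec_in_nonneg_orthant_iff y_nonneg)
  ultimately show "tensor_form m (card J) (principal_subtensor A J) x \<ge> 0"
    using A by (simp add: copositive_tensor_def)
qed

theorem theorem3p2:
  fixes m n :: nat and A :: tensor and J :: "nat set"
  assumes "m \<ge> 3" and "n \<ge> 2"
    and "symmetric_tensor m n A"
    and "copositive_tensor m n A"
    and "J \<subseteq> {..<n}" and "J \<noteq> {}"
  shows "\<exists>x \<in> nonneg_orthant (card J). x \<noteq> 0\<^sub>v (card J) \<and>
           tensor_apply m (card J) (principal_subtensor A J) x \<ge> 0\<^sub>v (card J)"
proof (rule copositive_tensor_apply_nonneg)
  show "symmetric_tensor m (card J) (principal_subtensor A J)"
    using assms(3,5) by (rule symmetric_principal_subtensor)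
  show "copositive_tensor m (card J) (principal_subtensor A J)"
    using assms(4,5) by (rule copositive_principal_subtensor)
  show "m > 0"
    using assms(1) by simp
  \<comment> \<open>Finiteness matters since \<open>card\<close> is \<open>0\<close> on infinite
    sets.\<close>
  have "finite J"
    using assms(5) by (rule finite_subset) simp
  then show "card J > 0"
    using assms(6) by (simp add: card_gt_0_iff)
qed

end
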